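(* Let $\Omega\subset\mathbb{R}^d$ be a bounded Lipschitz domain and let $\gamma\in\mathcal{M}(\Omega)$ be a finite positive measure. Then for every $u\in L^1(\Omega)$, $$\mathrm{TV}_{\mathrm{pwL}}^{\gamma}(u)=\big\|(|Du|-\gamma)_+\big\|_{\mathcal{M}},$$ where $(\cdot)_+$ denotes the positive part of a signed measure in the sense of the Hahn decomposition. (If $Du$ is not a finite Radon measure, i.e. $u\notin \mathrm{BV}(\Omega)$, both sides are understood as $+\infty$.)
   Context: $\mathcal{M}(\Omega)$ is the space of finite signed (scalar) Radon measures on $\Omega$, and $\|\mu\|_{\mathcal{M}}=|\mu|(\Omega)$. $\mathfrak{M}(\Omega;\mathbb{R}^d)$ is the space of finite $\mathbb{R}^d$-valued Radon measures; for $g$ in it, $|g|\in\mathcal{M}(\Omega)$ is its variation measure $|g|(E)=\sup\{\sum_{i}\|g(E_i)\|_2 : E=\bigcup_{i\in\mathbb{N}}E_i,\ E_i \text{ pairwise disjoint}\}$ (Euclidean norm, Borel sets), and $\|g\|_{\mathfrak{M}}=|g|(\Omega)$. A measure $\mu\in\mathcal{M}(\Omega)$ is positive if $\mu(E)\ge 0$ for every Borel $E\subseteq\Omega$; $\mu_1\le\mu_2$ means that $\mu_2-\mu_1$ is positive. $Du$ is the distributional gradient of $u$. For a finite positive measure $\gamma$ and $u\in L^1(\Omega)$, $$\mathrm{TV}_{\mathrm{pwL}}^{\gamma}(u):=\min_{g\in\mathfrak{M}(\Omega;\mathbb{R}^d),\ |g|\le\gamma}\|Du-g\|_{\mathfrak{M}},$$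 with value $+\infty$ if $Du$ is not a finite Radon measure. *)

theory Defs
  imports "HOL-Analysis.Analysis"
begin

definition borel_subsets :: "'a::topological_space set \<Rightarrow> 'a set set" where
  "borel_subsets \<Omega> = sets (restrict_space borel \<Omega>)"

(* Finite (vector) Radon measures on an open set are represented by their values on Borel
   subsets: finiteness is built into the value type, and regularity is automatic for finite
   Borel measures on open subsets of a Euclidean space. Values on other sets are irrelevant,
   so two representatives are identified when they agree on all Borel subsets of \<Omega>. Sums and
   differences of measures are the pointwise ones of the function type; the pointwise order of
   the function type is not used, because it would also compare the irrelevant values. *)
definition finite_radon :: "'a::euclidean_space set \<Rightarrow> ('a set \<Rightarrow> 'b::euclidean_space) \<Rightarrow> bool" where
  "finite_radon \<Omega> \<mu> \<longleftrightarrow>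
     \<mu> {} = 0 \<and>
     (\<forall>A. range A \<subseteq> borel_subsets \<Omega> \<longrightarrow> disjoint_family A \<longrightarrow>
        (\<lambda>i::nat. \<mu> (A i)) sums \<mu> (\<Union>i. A i))"

definition positive_on :: "'a::euclidean_space set \<Rightarrow> ('a set \<Rightarrow> real) \<Rightarrow> bool" where
  "positive_on \<Omega> \<mu> \<longleftrightarrow> (\<forall>E\<in>borel_subsets \<Omega>. 0 \<le> \<mu> E)"

definition measure_le :: "'a::euclidean_space set \<Rightarrow> ('a set \<Rightarrow> real) \<Rightarrow> ('a set \<Rightarrow> real) \<Rightarrow> bool" where
  "measure_le \<Omega> \<mu>\<^sub>1 \<mu>\<^sub>2 \<longleftrightarrow> positive_on \<Omega> (\<mu>\<^sub>2 - \<mu>\<^sub>1)"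

definition variation ::
    "'a::euclidean_space set \<Rightarrow> ('a set \<Rightarrow> 'b::euclidean_space) \<Rightarrow> 'a set \<Rightarrow> ennreal" where
  "variation \<Omega> g E =
     (SUP A \<in> {A. range A \<subseteq> borel_subsets \<Omega> \<and> disjoint_family A \<and> (\<Union>i. A i) = E}.
        \<Sum>i::nat. ennreal (norm (g (A i))))"

(* The variation of a finite Radon measure is finite, so enn2real loses no information there. *)
definition variation_measure ::
    "'a::euclidean_space set \<Rightarrow> ('a set \<Rightarrow> 'b::euclidean_space) \<Rightarrow> 'a set \<Rightarrow> real" where
  "variation_measure \<Omega> g E = enn2real (variation \<Omega> g E)"

definition radon_norm :: "'a::euclidean_space set \<Rightarrow> ('a set \<Rightarrow> 'b::euclidean_space) \<Rightarrow> ennreal" where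
  "radon_norm \<Omega> g = variation \<Omega> g \<Omega>"

definition hahn_set :: "'a::euclidean_space set \<Rightarrow> ('a set \<Rightarrow> real) \<Rightarrow> 'a set \<Rightarrow> bool" where
  "hahn_set \<Omega> \<mu> P \<longleftrightarrow>
     P \<in> borel_subsets \<Omega> \<and>
     (\<forall>E\<in>borel_subsets \<Omega>. E \<subseteq> P \<longrightarrow> 0 \<le> \<mu> E) \<and>
     (\<forall>E\<in>borel_subsets \<Omega>. E \<subseteq> \<Omega> - P \<longrightarrow> \<mu> E \<le> 0)"

(* A Hahn set is unique up to sets all of whose Borel subsets are null, so on Borel subsets of
   \<Omega> the value below does not depend on the choice. *)
definition positive_part :: "'a::euclidean_space set \<Rightarrow> ('a set \<Rightarrow> real) \<Rightarrow> 'a set \<Rightarrow> real" where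
  "positive_part \<Omega> \<mu> E = \<mu> (E \<inter> (SOME P. hahn_set \<Omega> \<mu> P))"

definition to_measure :: "'a::euclidean_space set \<Rightarrow> ('a set \<Rightarrow> real) \<Rightarrow> 'a measure" where
  "to_measure \<Omega> \<mu> = measure_of \<Omega> (borel_subsets \<Omega>) (\<lambda>E. ennreal (\<mu> E))"

(* Integral against a signed measure through its Jordan decomposition. *)
definition signed_integral :: "'a::euclidean_space set \<Rightarrow> ('a set \<Rightarrow> real) \<Rightarrow> ('a \<Rightarrow> real) \<Rightarrow> real" where
  "signed_integral \<Omega> \<mu> f =
     (LINT x | to_measure \<Omega> (positive_part \<Omega> \<mu>). f x) -
     (LINT x | to_measure \<Omega> (positive_part \<Omega> (- \<mu>)). f x)"

definition partial_deriv :: "'a::euclidean_space \<Rightarrow> ('a \<Rightarrow> real) \<Rightarrow> 'a \<Rightarrow> real" where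
  "partial_deriv b f x = frechet_derivative f (at x) b"

(* Infinitely differentiable: every iterated partial derivative is differentiable everywhere,
   hence in particular continuous. *)
definition smooth :: "('a::euclidean_space \<Rightarrow> real) \<Rightarrow> bool" where
  "smooth f \<longleftrightarrow>
     (\<forall>bs. set bs \<subseteq> Basis \<longrightarrow> (\<forall>x. (foldr partial_deriv bs f) differentiable (at x)))"

(* Smooth functions with compact support in \<Omega>, extended by zero to the whole space. *)
definition test_function :: "'a::euclidean_space set \<Rightarrow> ('a \<Rightarrow> real) \<Rightarrow> bool" where
  "test_function \<Omega> \<psi> \<longleftrightarrow>
     smooth \<psi> \<and> compact (closure {x. \<psi> x \<noteq> 0}) \<and> closure {x. \<psi> x \<noteq> 0} \<subseteq> \<Omega>"

definition has_gradient_measure ::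
    "'a::euclidean_space set \<Rightarrow> ('a \<Rightarrow> real) \<Rightarrow> ('a set \<Rightarrow> 'a) \<Rightarrow> bool" where
  "has_gradient_measure \<Omega> u \<nu> \<longleftrightarrow>
     finite_radon \<Omega> \<nu> \<and>
     (\<forall>\<psi>. test_function \<Omega> \<psi> \<longrightarrow> (\<forall>b\<in>Basis.
        (LINT x:\<Omega>|lebesgue. u x * partial_deriv b \<psi> x) =
          - signed_integral \<Omega> (\<lambda>E. \<nu> E \<bullet> b) \<psi>))"

definition bounded_variation :: "'a::euclidean_space set \<Rightarrow> ('a \<Rightarrow> real) \<Rightarrow> bool" where
  "bounded_variation \<Omega> u \<longleftrightarrow>
     u absolutely_integrable_on \<Omega> \<and> (\<exists>\<nu>. has_gradient_measure \<Omega> u \<nu>)"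

(* The distributional gradient, as a measure. It is meaningful for functions of bounded
   variation only, and its values on Borel subsets of \<Omega> are then uniquely determined. *)
definition gradient_measure :: "'a::euclidean_space set \<Rightarrow> ('a \<Rightarrow> real) \<Rightarrow> 'a set \<Rightarrow> 'a" where
  "gradient_measure \<Omega> u = (SOME \<nu>. has_gradient_measure \<Omega> u \<nu>)"

(* LEAST rather than INF: the value is a minimum, so an equation for it can only be proved by
   showing that the minimum is attained. *)
definition TV_pwL :: "'a::euclidean_space set \<Rightarrow> ('a set \<Rightarrow> real) \<Rightarrow> ('a \<Rightarrow> real) \<Rightarrow> ennreal" where
  "TV_pwL \<Omega> \<gamma> u =
     (if bounded_variation \<Omega> u
      then LEAST t. \<exists>g. finite_radon \<Omega> g \<and> measure_le \<Omega> (variation_measure \<Omega> g) \<gamma> \<and>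
                        t = radon_norm \<Omega> (gradient_measure \<Omega> u - g)
      else \<infinity>)"

(* Near each boundary point, after a rigid motion taking e to the last coordinate direction,
   \<Omega> is the region above the graph of a Lipschitz function of the remaining coordinates. *)
definition lipschitz_boundary :: "'a::euclidean_space set \<Rightarrow> bool" where
  "lipschitz_boundary \<Omega> \<longleftrightarrow>
     (\<forall>p\<in>frontier \<Omega>. \<exists>r e \<phi> L. 0 < r \<and> norm e = 1 \<and> L-lipschitz_on {y. y \<bullet> e = 0} \<phi> \<and>
        \<Omega> \<inter> ball p r = {x \<in> ball p r. \<phi> (x - (x \<bullet> e) *\<^sub>R e) < x \<bullet> e})"

definition bounded_lipschitz_domain :: "'a::euclidean_space set \<Rightarrow> bool" where
  "bounded_lipschitz_domain \<Omega> \<longleftrightarrow>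
     open \<Omega> \<and> connected \<Omega> \<and> \<Omega> \<noteq> {} \<and> bounded \<Omega> \<and> lipschitz_boundary \<Omega>"

end

theory Submission
  imports Defs
begin

text \<open>Only the fact that \<open>\<nu> = Du\<close> is a finite vector measure matters. Its variation is finite, so
  with respect to the finite positive measure \<open>|\<nu>| + \<gamma>\<close> both \<open>\<nu>\<close> and \<open>\<gamma>\<close> have densities
  \<open>h\<close> and \<open>c\<close>, and the variation of a measure with density \<open>f\<close> has density \<open>|f|\<close>. Truncating
  \<open>h\<close> at length \<open>c\<close> gives an admissible \<open>g\<close> for which \<open>\<nu> - g\<close> has variation
  \<open>(|h| - c)\<^sub>+\<close>, the density of \<open>(|\<nu>| - \<gamma>)\<^sub>+\<close>. Conversely, on a Hahn set \<open>P\<close> of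
  \<open>|\<nu>| - \<gamma>\<close>, every admissible \<open>g\<close> satisfies \<open>|\<nu> - g|(P) \<ge> |\<nu>|(P) - |g|(P) \<ge> |\<nu>|(P) - \<gamma>(P)\<close>.\<close>

section \<open>Borel subsets, additivity and boundedness of finite measures\<close>

lemma borel_subsets_sigma_algebra: "sigma_algebra \<Omega> (borel_subsets \<Omega>)"
  using sets.sigma_algebra_axioms[of "restrict_space borel \<Omega>"]
  by (simp add: borel_subsets_def space_restrict_space)

lemma borel_subsets_simps [simp, intro]:
  shows empty_borel_subsets: "{} \<in> borel_subsets \<Omega>"
    and space_borel_subsets: "\<Omega> \<in> borel_subsets \<Omega>"
    and Un_borel_subsets: "A \<in> borel_subsets \<Omega> \<Longrightarrow> B \<in> borel_subsets \<Omega> \<Longrightarrow> A \<union> B \<in> borel_subsets \<Omega>"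
    and Int_borel_subsets: "A \<in> borel_subsets \<Omega> \<Longrightarrow> B \<in> borel_subsets \<Omega> \<Longrightarrow> A \<inter> B \<in> borel_subsets \<Omega>"
    and Diff_borel_subsets: "A \<in> borel_subsets \<Omega> \<Longrightarrow> B \<in> borel_subsets \<Omega> \<Longrightarrow> A - B \<in> borel_subsets \<Omega>"
proof -
  interpret sigma_algebra \<Omega> "borel_subsets \<Omega>" by (rule borel_subsets_sigma_algebra)
  show "{} \<in> borel_subsets \<Omega>" "\<Omega> \<in> borel_subsets \<Omega>" by auto
  show "A \<in> borel_subsets \<Omega> \<Longrightarrow> B \<in> borel_subsets \<Omega> \<Longrightarrow> A \<union> B \<in> borel_subsets \<Omega>"
    "A \<in> borel_subsets \<Omega> \<Longrightarrow> B \<in> borel_subsets \<Omega> \<Longrightarrow> A \<inter> B \<in> borel_subsets \<Omega>"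
    "A \<in> borel_subsets \<Omega> \<Longrightarrow> B \<in> borel_subsets \<Omega> \<Longrightarrow> A - B \<in> borel_subsets \<Omega>" by auto
qed

lemma UN_borel_subsets [intro]:
  assumes "\<And>i::nat. i \<in> I \<Longrightarrow> A i \<in> borel_subsets \<Omega>"
  shows "(\<Union>i\<in>I. A i) \<in> borel_subsets \<Omega>"
proof -
  interpret sigma_algebra \<Omega> "borel_subsets \<Omega>" by (rule borel_subsets_sigma_algebra)
  show ?thesis using assms by (intro countable_UN') auto
qed

lemma borel_subsets_subset: "A \<in> borel_subsets \<Omega> \<Longrightarrow> A \<subseteq> \<Omega>"
  by (auto simp: borel_subsets_def sets_restrict_space)

lemma finite_radon_empty: "finite_radon \<Omega> \<mu> \<Longrightarrow> \<mu> {} = 0"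
  by (simp add: finite_radon_def)

lemma finite_radon_sums:
  "finite_radon \<Omega> \<mu> \<Longrightarrow> (\<And>i::nat. A i \<in> borel_subsets \<Omega>) \<Longrightarrow> disjoint_family A \<Longrightarrow>
    (\<lambda>i. \<mu> (A i)) sums \<mu> (\<Union>i. A i)"
  by (auto simp: finite_radon_def)

text \<open>Countable additivity applied to the sequence \<open>A\<close>, \<open>B\<close>,
  \<open>{}\<close>, \<open>{}\<close>, ..., whose tail contributes nothing.\<close>

lemma finite_radon_Un:
  assumes \<mu>: "finite_radon \<Omega> \<mu>" and A: "A \<in> borel_subsets \<Omega>" and B: "B \<in> borel_subsets \<Omega>"
    and "A \<inter> B = {}"
  shows "\<mu> (A \<union> B) = \<mu> A + \<mu> B"
proof -
  have "(\<lambda>i. \<mu> (binaryset A B i)) sums \<mu> (\<Union>i. binaryset A B i)"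
    using assms by (intro finite_radon_sums)
      (auto simp: binaryset_def disjoint_family_on_def split: if_splits)
  moreover have "(\<lambda>i. \<mu> (binaryset A B i)) sums (\<mu> A + \<mu> B)"
    by (rule binaryset_sums) (rule finite_radon_empty[OF \<mu>])
  ultimately show ?thesis
    by (metis UN_binaryset_eq sums_unique2)
qed

lemma finite_radon_Diff:
  assumes \<mu>: "finite_radon \<Omega> \<mu>" and "A \<in> borel_subsets \<Omega>" "B \<in> borel_subsets \<Omega>" "B \<subseteq> A"
  shows "\<mu> (A - B) = \<mu> A - \<mu> B"
proof -
  have "\<mu> (A - B \<union> B) = \<mu> (A - B) + \<mu> B"
    using assms by (intro finite_radon_Un) auto
  moreover have "A - B \<union> B = A" using \<open>B \<subseteq> A\<close> by auto
  ultimately show ?thesis by simp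
qed

lemma finite_radon_add:
  "finite_radon \<Omega> \<mu> \<Longrightarrow> finite_radon \<Omega> \<nu> \<Longrightarrow> finite_radon \<Omega> (\<lambda>E. \<mu> E + \<nu> E)"
  by (auto simp: finite_radon_def intro!: sums_add)

lemma finite_radon_diff:
  "finite_radon \<Omega> \<mu> \<Longrightarrow> finite_radon \<Omega> \<nu> \<Longrightarrow> finite_radon \<Omega> (\<lambda>E. \<mu> E - \<nu> E)"
  by (auto simp: finite_radon_def intro!: sums_diff)

lemma finite_radon_inner:
  "finite_radon \<Omega> \<mu> \<Longrightarrow> finite_radon \<Omega> (\<lambda>E. \<mu> E \<bullet> b)"
  by (auto simp: finite_radon_def intro!: bounded_linear.sums[OF bounded_linear_inner_left])

text \<open>A set on whose subsets \<open>\<mu>\<close> is unbounded could be cut repeatedly into such a set again, each time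
  discarding a piece with \<open>\<mu>\<close>-value of norm at least 1; the discarded pieces are disjoint and
  contradict countable additivity.\<close>

lemma finite_radon_bounded:
  fixes \<mu> :: "'a::euclidean_space set \<Rightarrow> 'b::euclidean_space"
  assumes \<mu>: "finite_radon \<Omega> \<mu>"
  shows "\<exists>B. \<forall>A\<in>borel_subsets \<Omega>. norm (\<mu> A) \<le> B"
proof (rule ccontr)
  define bad where "bad E \<longleftrightarrow> E \<in> borel_subsets \<Omega> \<and>
    (\<forall>B. \<exists>F\<in>borel_subsets \<Omega>. F \<subseteq> E \<and> B < norm (\<mu> F))" for E
  assume "\<not> ?thesis"
  then have "\<exists>A\<in>borel_subsets \<Omega>. B < norm (\<mu> A)" for B
    by (meson not_le)
  then have "\<exists>A\<in>borel_subsets \<Omega>. A \<subseteq> \<Omega> \<and> B < norm (\<mu> A)" for B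
    using borel_subsets_subset[of _ \<Omega>] by meson
  then have bad0: "bad \<Omega>"
    unfolding bad_def by simp
  have step: "\<exists>E'. bad E' \<and> E' \<subseteq> E \<and> 1 \<le> norm (\<mu> (E - E'))" if E: "bad E" for E
  proof -
    \<comment> \<open>The threshold makes both \<open>F\<close> and \<open>E - F\<close> have values
      of norm at least 1. Whichever of the two turns out to be bad can therefore be kept, with the
      other one discarded.\<close>
    obtain F where F: "F \<in> borel_subsets \<Omega>" "F \<subseteq> E" "1 + norm (\<mu> E) < norm (\<mu> F)"
      using E unfolding bad_def by blast
    have EB: "E \<in> borel_subsets \<Omega>" using E by (simp add: bad_def)
    have d: "\<mu> (E - F) = \<mu> E - \<mu> F" by (rule finite_radon_Diff[OF \<mu> EB F(1,2)])
    have n1: "1 \<le> norm (\<mu> (E - F))"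
      using F(3) norm_triangle_ineq2[of "\<mu> F" "\<mu> E"] by (simp add: d norm_minus_commute)
    have n2: "1 \<le> norm (\<mu> (E - (E - F)))"
      using F norm_ge_zero[of "\<mu> E"] by (simp add: double_diff del: norm_ge_zero)
    show ?thesis
    proof (cases "bad F")
      case True then show ?thesis using F n1 by blast
    next
      case False
      then obtain B where B: "\<And>G. G \<in> borel_subsets \<Omega> \<Longrightarrow> G \<subseteq> F \<Longrightarrow> norm (\<mu> G) \<le> B"
        using F unfolding bad_def by (auto simp: not_less)
      have "\<exists>G\<in>borel_subsets \<Omega>. G \<subseteq> E - F \<and> C < norm (\<mu> G)" for C
      proof -
        \<comment> \<open>If subsets of \<open>F\<close> have values bounded by \<open>B\<close>, a
          subset \<open>H\<close> of \<open>E\<close> whose value exceeds \<open>C + B\<close> must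
          owe more than \<open>C\<close> to its part outside \<open>F\<close>; hence
          \<open>E - F\<close> is bad.\<close>
        obtain H where H: "H \<in> borel_subsets \<Omega>" "H \<subseteq> E" "C + B < norm (\<mu> H)"
          using E unfolding bad_def by blast
        have "\<mu> (H - F \<union> H \<inter> F) = \<mu> (H - F) + \<mu> (H \<inter> F)"
          using H F by (intro finite_radon_Un[OF \<mu>]) auto
        then have "norm (\<mu> H) \<le> norm (\<mu> (H - F)) + norm (\<mu> (H \<inter> F))"
          by (simp add: Un_Diff_Int norm_triangle_ineq)
        with B[of "H \<inter> F"] H F have "C < norm (\<mu> (H - F))" by auto
        with H F show ?thesis by (intro bexI[of _ "H - F"]) auto
      qed
      then have "bad (E - F)" using EB F by (auto simp: bad_def)
      with n2 show ?thesis by blast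
    qed
  qed
  have "\<exists>S. \<forall>n. bad (S n) \<and> S (Suc n) \<subseteq> S n \<and> 1 \<le> norm (\<mu> (S n - S (Suc n)))"
    using bad0 step by (intro dependent_nat_choice) auto
  then obtain S where S: "\<And>n. bad (S n)" "\<And>n. S (Suc n) \<subseteq> S n"
    "\<And>n. 1 \<le> norm (\<mu> (S n - S (Suc n)))"
    by blast
  have dec: "i \<le> j \<Longrightarrow> S j \<subseteq> S i" for i j
    using S(2) by (rule lift_Suc_antimono_le)
  have "disjoint_family (\<lambda>n. S n - S (Suc n))"
    unfolding disjoint_family_on_def
  proof (intro ballI impI)
    fix i j :: nat assume "i \<noteq> j"
    then consider "Suc i \<le> j" | "Suc j \<le> i" by linarith
    then show "(S i - S (Suc i)) \<inter> (S j - S (Suc j)) = {}"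
      using dec[of "Suc i" j] dec[of "Suc j" i] by cases auto
  qed
  then have "(\<lambda>n. \<mu> (S n - S (Suc n))) sums \<mu> (\<Union>n. S n - S (Suc n))"
    using S(1) by (intro finite_radon_sums[OF \<mu>]) (auto simp: bad_def)
  then have "(\<lambda>n. \<mu> (S n - S (Suc n))) \<longlonglongrightarrow> 0"
    by (intro summable_LIMSEQ_zero) (auto simp: summable_def)
  then have "\<forall>\<^sub>F n in sequentially. norm (\<mu> (S n - S (Suc n))) < 1"
    by (auto simp: tendsto_iff)
  then obtain n where "norm (\<mu> (S n - S (Suc n))) < 1"
    by (auto simp: eventually_sequentially)
  with S(3)[of n] show False by simp
qed

section \<open>The variation: finiteness and countable additivity\<close>

lemma variation_upper:
  assumes "\<And>i::nat. A i \<in> borel_subsets \<Omega>" "disjoint_family A" "(\<Union>i. A i) = E"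
  shows "(\<Sum>i. ennreal (norm (g (A i)))) \<le> variation \<Omega> g E"
  unfolding variation_def using assms by (intro SUP_upper) auto

lemma variation_least:
  assumes "\<And>A. (\<And>i::nat. A i \<in> borel_subsets \<Omega>) \<Longrightarrow> disjoint_family A \<Longrightarrow> (\<Union>i. A i) = E \<Longrightarrow>
    (\<Sum>i. ennreal (norm (g (A i)))) \<le> b"
  shows "variation \<Omega> g E \<le> b"
  unfolding variation_def by (rule SUP_least, clarify, rule assms) blast+

lemma norm_le_variation:
  assumes \<mu>: "finite_radon \<Omega> \<mu>" and E: "E \<in> borel_subsets \<Omega>"
  shows "ennreal (norm (\<mu> E)) \<le> variation \<Omega> \<mu> E"
proof -
  have "(\<Sum>i. ennreal (norm (\<mu> (binaryset E {} i)))) \<le> variation \<Omega> \<mu> E"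
    using E by (intro variation_upper)
      (auto simp: binaryset_def disjoint_family_on_def split: if_splits)
  also have "(\<Sum>i. ennreal (norm (\<mu> (binaryset E {} i)))) =
      ennreal (norm (\<mu> E)) + ennreal (norm (\<mu> {}))"
    by (rule suminf_binaryset_eq) (simp add: finite_radon_empty[OF \<mu>])
  finally show ?thesis by (simp add: finite_radon_empty[OF \<mu>])
qed

text \<open>Split the indices by the sign of \<open>\<mu> (A i)\<close>. Within each class the
  absolute values add up without cancellation to the absolute value of \<open>\<mu>\<close> on a
  union, which is at most \<open>B\<close>.\<close>

lemma sum_le_twice_bound:
  fixes \<mu> :: "'a::euclidean_space set \<Rightarrow> real"
  assumes \<mu>: "finite_radon \<Omega> \<mu>" and B: "\<And>A. A \<in> borel_subsets \<Omega> \<Longrightarrow> \<bar>\<mu> A\<bar> \<le> B"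
    and A: "\<And>i::nat. A i \<in> borel_subsets \<Omega>" "disjoint_family A" and "finite I"
  shows "(\<Sum>i\<in>I. \<bar>\<mu> (A i)\<bar>) \<le> 2 * B"
proof -
  have fin: "\<mu> (\<Union>i\<in>J. A i) = (\<Sum>i\<in>J. \<mu> (A i))" if "finite J" for J
    using that
  proof induction
    case (insert j J)
    have "\<mu> (A j \<union> (\<Union>i\<in>J. A i)) = \<mu> (A j) + \<mu> (\<Union>i\<in>J. A i)"
    proof (intro finite_radon_Un[OF \<mu>])
      have "A j \<inter> A i = {}" if "i \<in> J" for i
        using insert that A(2) by (intro disjoint_family_onD[OF A(2)]) auto
      then show "A j \<inter> (\<Union>i\<in>J. A i) = {}" by blast
    qed (use A in auto)
    with insert show ?case by simp
  qed (simp add: finite_radon_empty[OF \<mu>])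
  let ?P = "{i\<in>I. 0 \<le> \<mu> (A i)}" and ?N = "{i\<in>I. \<mu> (A i) < 0}"
  have I: "?P \<union> ?N = I" by auto
  have "(\<Sum>i\<in>?P \<union> ?N. \<bar>\<mu> (A i)\<bar>) = (\<Sum>i\<in>?P. \<bar>\<mu> (A i)\<bar>) + (\<Sum>i\<in>?N. \<bar>\<mu> (A i)\<bar>)"
    using \<open>finite I\<close> by (intro sum.union_disjoint) auto
  also have "\<dots> = \<mu> (\<Union>i\<in>?P. A i) - \<mu> (\<Union>i\<in>?N. A i)"
    using \<open>finite I\<close> by (simp add: fin sum_negf)
  also have "\<dots> \<le> B + B"
    using B[of "\<Union>i\<in>?P. A i"] B[of "\<Union>i\<in>?N. A i"] A by (fastforce simp: abs_le_iff)
  finally show ?thesis unfolding I by simp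
qed

text \<open>The Euclidean norm is at most the sum of the absolute coordinates, and each coordinate
  is a scalar measure with the uniform bound \<open>B\<close>. The sign splitting then gives at most
  \<open>2 * B\<close> per coordinate, independently of the partition.\<close>

lemma variation_finite:
  fixes \<mu> :: "'a::euclidean_space set \<Rightarrow> 'b::euclidean_space"
  assumes \<mu>: "finite_radon \<Omega> \<mu>"
  shows "variation \<Omega> \<mu> E < \<infinity>"
proof -
  obtain B where B: "\<And>A. A \<in> borel_subsets \<Omega> \<Longrightarrow> norm (\<mu> A) \<le> B"
    using finite_radon_bounded[OF \<mu>] by blast
  have "variation \<Omega> \<mu> E \<le> ennreal (real DIM('b) * (2 * B))"
  proof (rule variation_least)
    fix A :: "nat \<Rightarrow> 'a set"
    assume A: "\<And>i. A i \<in> borel_subsets \<Omega>" "disjoint_family A"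
    have *: "(\<Sum>i<n. norm (\<mu> (A i))) \<le> real DIM('b) * (2 * B)" for n
    proof -
      have "(\<Sum>i<n. norm (\<mu> (A i))) \<le> (\<Sum>i<n. \<Sum>b\<in>Basis. \<bar>\<mu> (A i) \<bullet> b\<bar>)"
        by (intro sum_mono norm_le_l1)
      also have "\<dots> = (\<Sum>b\<in>Basis. \<Sum>i<n. \<bar>\<mu> (A i) \<bullet> b\<bar>)" by (rule sum.swap)
      also have "\<dots> \<le> (\<Sum>b\<in>(Basis::'b set). 2 * B)"
      proof (intro sum_mono sum_le_twice_bound[OF finite_radon_inner[OF \<mu>]])
        fix b :: 'b and F assume "b \<in> Basis" "F \<in> borel_subsets \<Omega>"
        then show "\<bar>\<mu> F \<bullet> b\<bar> \<le> B"
          using B[of F] Basis_le_norm[of b "\<mu> F"] by simp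
      qed (use A in auto)
      finally show ?thesis by simp
    qed
    show "(\<Sum>i. ennreal (norm (\<mu> (A i)))) \<le> ennreal (real DIM('b) * (2 * B))"
      using * by (intro suminf_le_const) (auto simp: sum_ennreal ennreal_leI)
  qed
  then show ?thesis by (metis ennreal_less_top infinity_ennreal_def le_less_trans)
qed

lemma ennreal_variation_measure:
  "finite_radon \<Omega> \<mu> \<Longrightarrow> ennreal (variation_measure \<Omega> \<mu> E) = variation \<Omega> \<mu> E"
  using variation_finite[of \<Omega> \<mu> E] by (simp add: variation_measure_def)

text \<open>Tonelli, with one of the two sums read as an integral over the counting measure.\<close>

lemma suminf_swap_ennreal:
  fixes f :: "nat \<Rightarrow> nat \<Rightarrow> ennreal"
  shows "(\<Sum>i. \<Sum>j. f i j) = (\<Sum>j. \<Sum>i. f i j)"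
proof -
  have "(\<Sum>i. \<integral>\<^sup>+j. f i j \<partial>count_space UNIV) = (\<integral>\<^sup>+j. (\<Sum>i. f i j) \<partial>count_space UNIV)"
    by (rule nn_integral_suminf[symmetric]) simp
  then show ?thesis by (simp add: nn_integral_count_space_nat)
qed

text \<open>Refine a partition \<open>A\<close> of the union by the sets \<open>E n\<close>, then
  exchange the two sums: for fixed \<open>n\<close> the pieces \<open>A j \<inter> E n\<close>
  partition \<open>E n\<close>.\<close>

lemma variation_subadditive:
  assumes \<mu>: "finite_radon \<Omega> \<mu>" and E: "\<And>n::nat. E n \<in> borel_subsets \<Omega>" "disjoint_family E"
  shows "variation \<Omega> \<mu> (\<Union>n. E n) \<le> (\<Sum>n. variation \<Omega> \<mu> (E n))"
proof (rule variation_least)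
  fix A :: "nat \<Rightarrow> _"
  assume A: "\<And>i. A i \<in> borel_subsets \<Omega>" "disjoint_family A" "(\<Union>i. A i) = (\<Union>n. E n)"
  \<comment> \<open>If the norms are summable this is the triangle inequality for series; otherwise
    the right side is infinite.\<close>
  have "ennreal (norm (\<mu> (A j))) \<le> (\<Sum>n. ennreal (norm (\<mu> (A j \<inter> E n))))" for j
  proof (cases "summable (\<lambda>n. norm (\<mu> (A j \<inter> E n)))")
    case True
    have "(\<lambda>n. \<mu> (A j \<inter> E n)) sums \<mu> (\<Union>n. A j \<inter> E n)"
      using A(1) E disjoint_family_on_bisimulation[OF E(2), of "\<lambda>n. A j \<inter> E n"]
      by (intro finite_radon_sums[OF \<mu>]) blast+
    moreover have "(\<Union>n. A j \<inter> E n) = A j" using A(3) by blast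
    ultimately have "\<mu> (A j) = (\<Sum>n. \<mu> (A j \<inter> E n))" by (simp add: sums_iff)
    then show ?thesis
      using summable_norm[OF True] True by (simp add: suminf_ennreal2 ennreal_leI)
  next
    case False
    then have "(\<Sum>n. ennreal (norm (\<mu> (A j \<inter> E n)))) = top"
      using summable_suminf_not_top[OF norm_ge_zero, of "\<lambda>n. \<mu> (A j \<inter> E n)"] by blast
    then show ?thesis by simp
  qed
  then have "(\<Sum>j. ennreal (norm (\<mu> (A j)))) \<le> (\<Sum>j. \<Sum>n. ennreal (norm (\<mu> (A j \<inter> E n))))"
    by (intro suminf_le) auto
  also have "\<dots> = (\<Sum>n. \<Sum>j. ennreal (norm (\<mu> (A j \<inter> E n))))" by (rule suminf_swap_ennreal)
  also have "\<dots> \<le> (\<Sum>n. variation \<Omega> \<mu> (E n))"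
  proof (intro suminf_le variation_upper)
    fix n show "(\<Union>i. A i \<inter> E n) = E n" using A(3) by blast
  qed (use A E in \<open>auto simp: disjoint_family_on_def\<close>)
  finally show "(\<Sum>j. ennreal (norm (\<mu> (A j)))) \<le> (\<Sum>n. variation \<Omega> \<mu> (E n))" .
qed

text \<open>A partition of \<open>E\<close> and one of \<open>F\<close> interleave to a partition of
  \<open>E \<union> F\<close> whose sum is the total of both. Taking suprema over the two partitions
  independently gives the claim.\<close>

lemma variation_superadditive:
  assumes E: "E \<in> borel_subsets \<Omega>" and F: "F \<in> borel_subsets \<Omega>" and "E \<inter> F = {}"
    and 0: "\<mu> {} = 0"
  shows "variation \<Omega> \<mu> E + variation \<Omega> \<mu> F \<le> variation \<Omega> \<mu> (E \<union> F)"
proof -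
  let ?P = "\<lambda>E. {A. range A \<subseteq> borel_subsets \<Omega> \<and> disjoint_family A \<and> (\<Union>i::nat. A i) = E}"
  \<comment> \<open>Moving a summand into a supremum requires a nonempty index set; \<open>E\<close>
    padded with empty sets is a partition.\<close>
  have ne: "?P E \<noteq> {}" if "E \<in> borel_subsets \<Omega>" for E
    using that by (auto intro!: exI[of _ "binaryset E {}"]
      simp: binaryset_def disjoint_family_on_def split: if_splits)
  have *: "(\<Sum>i. ennreal (norm (\<mu> (A i)))) + (\<Sum>i. ennreal (norm (\<mu> (B i))))
      \<le> variation \<Omega> \<mu> (E \<union> F)" if A: "A \<in> ?P E" and B: "B \<in> ?P F" for A B
  proof -
    define C where "C i = (if even i then A (i div 2) else B (i div 2))" for i
    have "(\<Sum>i. ennreal (norm (\<mu> (A i)))) + (\<Sum>i. ennreal (norm (\<mu> (B i)))) =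
        (\<Sum>i. ennreal (norm (\<mu> (A i))) + ennreal (norm (\<mu> (B i))))"
      by (rule suminf_add) auto
    also have "\<dots> \<le> (\<Sum>i. ennreal (norm (\<mu> (C i))))"
    proof (rule suminf_le_const)
      fix n
      have "(\<Sum>i<n. ennreal (norm (\<mu> (A i))) + ennreal (norm (\<mu> (B i)))) =
          (\<Sum>i<2*n. ennreal (norm (\<mu> (C i))))"
        by (induction n) (auto simp: C_def add.assoc)
      also have "\<dots> \<le> (\<Sum>i. ennreal (norm (\<mu> (C i))))"
        by (rule sum_le_suminf) auto
      finally show "(\<Sum>i<n. ennreal (norm (\<mu> (A i))) + ennreal (norm (\<mu> (B i)))) \<le>
        (\<Sum>i. ennreal (norm (\<mu> (C i))))" .
    qed auto
    also have "\<dots> \<le> variation \<Omega> \<mu> (E \<union> F)"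
    proof (rule variation_upper)
      show "C i \<in> borel_subsets \<Omega>" for i using A B by (auto simp: C_def)
      show "disjoint_family C"
        unfolding disjoint_family_on_def
      proof (intro ballI impI)
        fix i j :: nat assume "i \<noteq> j"
        \<comment> \<open>A number is determined by its half and its parity: different halves are
          handled by disjointness within \<open>A\<close> or \<open>B\<close>, different parities by
          that of \<open>E\<close> and \<open>F\<close>.\<close>
        then have ij: "i div 2 \<noteq> j div 2 \<or> even i \<noteq> even j"
          by (metis bit_eq_rec even_iff_mod_2_eq_zero)
        have AB: "A i \<inter> B j = {}" for i j using A B \<open>E \<inter> F = {}\<close> by blast
        have AA: "A i \<inter> A j = {}" "B i \<inter> B j = {}" if "i \<noteq> j" for i j
          using A B that by (auto simp: disjoint_family_on_def)
        show "C i \<inter> C j = {}"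
          using ij AB[of "i div 2" "j div 2"] AB[of "j div 2" "i div 2"] AA[of "i div 2" "j div 2"]
          by (cases "even i"; cases "even j") (simp_all add: C_def Int_commute)
      qed
      have "C (2 * i) = A i" "C (Suc (2 * i)) = B i" for i by (simp_all add: C_def)
      then have "(\<Union>i. A i) \<subseteq> (\<Union>i. C i)" "(\<Union>i. B i) \<subseteq> (\<Union>i. C i)"
        by (metis UN_least UN_upper UNIV_I)+
      moreover have "(\<Union>i. C i) \<subseteq> (\<Union>i. A i) \<union> (\<Union>i. B i)"
        by (rule UN_least) (auto simp: C_def)
      moreover have "(\<Union>i. A i) = E" "(\<Union>i. B i) = F" using A B by simp_all
      ultimately show "(\<Union>i. C i) = E \<union> F" by (simp add: subset_antisym)
    qed
    finally show ?thesis .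
  qed
  let ?S = "\<lambda>A. \<Sum>i::nat. ennreal (norm (\<mu> (A i)))"
  have v: "variation \<Omega> \<mu> E = (SUP A\<in>?P E. ?S A)" for E
    by (simp only: variation_def)
  have "(SUP A\<in>?P E. ?S A) + (SUP B\<in>?P F. ?S B) = (SUP B\<in>?P F. (SUP A\<in>?P E. ?S A) + ?S B)"
    by (rule ennreal_SUP_add_right[OF ne[OF F]])
  also have "\<dots> = (SUP B\<in>?P F. SUP A\<in>?P E. ?S A + ?S B)"
    by (simp only: ennreal_SUP_add_left[OF ne[OF E]])
  also have "\<dots> \<le> variation \<Omega> \<mu> (E \<union> F)"
    by (rule SUP_least, rule SUP_least, rule *)
  finally show ?thesis by (simp only: v[of E] v[of F])
qed

lemma variation_empty: "\<mu> {} = 0 \<Longrightarrow> variation \<Omega> \<mu> {} = 0"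
  by (rule antisym[OF variation_least]) auto

lemma variation_mono:
  assumes "\<mu> {} = 0" "E \<in> borel_subsets \<Omega>" "F \<in> borel_subsets \<Omega>" "E \<subseteq> F"
  shows "variation \<Omega> \<mu> E \<le> variation \<Omega> \<mu> F"
proof -
  have "variation \<Omega> \<mu> E \<le> variation \<Omega> \<mu> E + variation \<Omega> \<mu> (F - E)" by simp
  also have "\<dots> \<le> variation \<Omega> \<mu> (E \<union> (F - E))"
    using assms by (intro variation_superadditive) auto
  also have "E \<union> (F - E) = F" using assms by auto
  finally show ?thesis .
qed

text \<open>Superadditivity and induction bound every partial sum by the variation of a finite
  union, hence by monotonicity by that of the full union. Subadditivity is the converse
  inequality.\<close>

lemma variation_countably_additive:
  assumes \<mu>: "finite_radon \<Omega> \<mu>" and E: "\<And>n::nat. E n \<in> borel_subsets \<Omega>" "disjoint_family E"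
  shows "(\<Sum>n. variation \<Omega> \<mu> (E n)) = variation \<Omega> \<mu> (\<Union>n. E n)"
proof (rule antisym)
  have 0: "\<mu> {} = 0" by (rule finite_radon_empty[OF \<mu>])
  have "(\<Sum>i<n. variation \<Omega> \<mu> (E i)) \<le> variation \<Omega> \<mu> (\<Union>i<n. E i)" for n
  proof (induction n)
    case (Suc n)
    have "(\<Sum>i<Suc n. variation \<Omega> \<mu> (E i)) \<le> variation \<Omega> \<mu> (\<Union>i<n. E i) + variation \<Omega> \<mu> (E n)"
      using Suc by (simp add: add_right_mono)
    also have "\<dots> \<le> variation \<Omega> \<mu> ((\<Union>i<n. E i) \<union> E n)"
    proof (intro variation_superadditive 0)
      have "E i \<inter> E n = {}" if "i < n" for i
        using that by (intro disjoint_family_onD[OF E(2)]) auto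
      then show "(\<Union>i<n. E i) \<inter> E n = {}" by blast
    qed (use E(1) in auto)
    finally show ?case by (simp only: lessThan_Suc UN_insert Un_commute)
  qed simp
  also have "variation \<Omega> \<mu> (\<Union>i<n. E i) \<le> variation \<Omega> \<mu> (\<Union>i. E i)" for n
    using E by (intro variation_mono 0) auto
  finally show "(\<Sum>n. variation \<Omega> \<mu> (E n)) \<le> variation \<Omega> \<mu> (\<Union>n. E n)"
    by (intro suminf_le_const) auto
qed (rule variation_subadditive[OF assms])

text \<open>Since the variation is finite, its additivity passes to real values, so that the
  variation can itself be added to and subtracted from measures.\<close>

lemma finite_radon_variation_measure:
  assumes \<mu>: "finite_radon \<Omega> \<mu>"
  shows "finite_radon \<Omega> (variation_measure \<Omega> \<mu>)"
  unfolding finite_radon_def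
proof (intro conjI allI impI)
  show "variation_measure \<Omega> \<mu> {} = 0"
    by (simp add: variation_measure_def variation_empty finite_radon_empty[OF \<mu>])
  fix E :: "nat \<Rightarrow> _" assume "range E \<subseteq> borel_subsets \<Omega>" "disjoint_family E"
  then have "(\<Sum>n. ennreal (variation_measure \<Omega> \<mu> (E n))) = ennreal (variation_measure \<Omega> \<mu> (\<Union>n. E n))"
    unfolding ennreal_variation_measure[OF \<mu>] by (intro variation_countably_additive[OF \<mu>]) auto
  then have "(\<lambda>n. ennreal (variation_measure \<Omega> \<mu> (E n))) sums ennreal (variation_measure \<Omega> \<mu> (\<Union>n. E n))"
    by (metis summableI summable_sums)
  then show "(\<lambda>n. variation_measure \<Omega> \<mu> (E n)) sums variation_measure \<Omega> \<mu> (\<Union>n. E n)"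
    by (subst (asm) sums_ennreal) (auto simp: variation_measure_def)
qed

text \<open>Values off the Borel subsets are arbitrary, so a measure described by a density only on
  Borel sets inherits its additivity through this transfer.\<close>

lemma finite_radon_cong:
  assumes "\<And>E. E \<in> borel_subsets \<Omega> \<Longrightarrow> \<mu> E = \<nu> E" "finite_radon \<Omega> \<mu>"
  shows "finite_radon \<Omega> \<nu>"
  unfolding finite_radon_def
proof (intro conjI allI impI)
  show "\<nu> {} = 0" using assms by (metis empty_borel_subsets finite_radon_empty)
  fix A :: "nat \<Rightarrow> _" assume A: "range A \<subseteq> borel_subsets \<Omega>" "disjoint_family A"
  then have "(\<lambda>i. \<mu> (A i)) sums \<mu> (\<Union>i. A i)"
    by (intro finite_radon_sums[OF assms(2)]) auto
  moreover have "\<mu> (A i) = \<nu> (A i)" for i using A by (intro assms(1)) auto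
  moreover have "\<mu> (\<Union>i. A i) = \<nu> (\<Union>i. A i)" using A by (intro assms(1)) auto
  ultimately show "(\<lambda>i. \<nu> (A i)) sums \<nu> (\<Union>i. A i)" by simp
qed

section \<open>Measures with densities, their variation, and Radon-Nikodym\<close>

lemma space_to_measure [simp]: "space (to_measure \<Omega> \<mu>) = \<Omega>"
  by (simp add: to_measure_def space_measure_of_conv)

lemma sets_to_measure [simp]: "sets (to_measure \<Omega> \<mu>) = borel_subsets \<Omega>"
proof -
  interpret sigma_algebra \<Omega> "borel_subsets \<Omega>" by (rule borel_subsets_sigma_algebra)
  show ?thesis
    using space_closed by (simp add: to_measure_def sigma_sets_eq)
qed

lemma emeasure_to_measure:
  assumes \<mu>: "finite_radon \<Omega> \<mu>" "positive_on \<Omega> \<mu>" and E: "E \<in> borel_subsets \<Omega>"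
  shows "emeasure (to_measure \<Omega> \<mu>) E = ennreal (\<mu> E)"
  unfolding to_measure_def
proof (rule emeasure_measure_of_sigma)
  show "sigma_algebra \<Omega> (borel_subsets \<Omega>)" by (rule borel_subsets_sigma_algebra)
  show "positive (borel_subsets \<Omega>) (\<lambda>E. ennreal (\<mu> E))"
    by (simp add: positive_def finite_radon_empty[OF \<mu>(1)])
  show "countably_additive (borel_subsets \<Omega>) (\<lambda>E. ennreal (\<mu> E))"
    unfolding countably_additive_def
  proof (intro allI impI)
    fix A :: "nat \<Rightarrow> _" assume "range A \<subseteq> borel_subsets \<Omega>" "disjoint_family A"
    then show "(\<Sum>i. ennreal (\<mu> (A i))) = ennreal (\<mu> (\<Union>i. A i))"
      using \<mu>(2) by (intro suminf_ennreal_eq finite_radon_sums[OF \<mu>(1)]) (auto simp: positive_on_def)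
  qed
qed (rule E)

lemma finite_measure_to_measure:
  assumes "finite_radon \<Omega> \<mu>" "positive_on \<Omega> \<mu>"
  shows "finite_measure (to_measure \<Omega> \<mu>)"
  by (rule finite_measureI) (simp add: emeasure_to_measure assms)

lemma set_integrable_borel_subset:
  fixes f :: "'a::euclidean_space \<Rightarrow> 'b::euclidean_space"
  assumes "sets M = borel_subsets \<Omega>" "integrable M f" "E \<in> borel_subsets \<Omega>"
  shows "set_integrable M E f"
  unfolding set_integrable_def using assms by (intro integrable_mult_indicator) auto

text \<open>The partial sums are integrals over the finite unions, which increase to the full union;
  continuity of the integral along increasing sets gives the limit.\<close>

lemma finite_radon_density:
  fixes f :: "'a::euclidean_space \<Rightarrow> 'b::euclidean_space"
  assumes M: "sets M = borel_subsets \<Omega>" and f: "integrable M f"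
  shows "finite_radon \<Omega> (\<lambda>E. LINT x:E|M. f x)"
  unfolding finite_radon_def
proof (intro conjI allI impI)
  show "(LINT x:{}|M. f x) = 0" by (simp add: set_lebesgue_integral_def)
  fix A :: "nat \<Rightarrow> _" assume A: "range A \<subseteq> borel_subsets \<Omega>" "disjoint_family A"
  have "(LINT x:(\<Union>i<n. A i)|M. f x) = (\<Sum>i<n. LINT x:A i|M. f x)" for n
    using A by (intro set_integral_finite_Union) 
      (auto simp: M disjoint_family_on_def intro!: set_integrable_borel_subset[OF M f])
  moreover have "(\<lambda>n. LINT x:(\<Union>i<n. A i)|M. f x) \<longlonglongrightarrow> (LINT x:(\<Union>n. \<Union>i<n. A i)|M. f x)"
    using A by (intro set_integral_cont_up set_integrable_borel_subset[OF M f])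
      (auto simp: M lessThan_Suc intro!: incseq_SucI UN_borel_subsets)
  moreover have "(\<Union>n. \<Union>i<n. A i) = (\<Union>i. A i)" by auto
  ultimately show "(\<lambda>i. LINT x:A i|M. f x) sums (LINT x:(\<Union>i. A i)|M. f x)"
    by (simp add: sums_def)
qed

text \<open>The lower bound is obtained by partitioning along the preimages of countably many small
  balls covering the range of the density, on each of which the density is nearly constant.\<close>

lemma variation_density:
  fixes h :: "'a::euclidean_space \<Rightarrow> 'b::euclidean_space"
  assumes "finite_measure M" and M: "sets M = borel_subsets \<Omega>" and h: "integrable M h"
    and \<nu>: "\<And>E. E \<in> borel_subsets \<Omega> \<Longrightarrow> \<nu> E = (LINT x:E|M. h x)"
    and E: "E \<in> borel_subsets \<Omega>"
  shows "variation \<Omega> \<nu> E = ennreal (LINT x:E|M. norm (h x))"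
proof (rule antisym)
  interpret finite_measure M by fact
  note int = set_integrable_borel_subset[OF M h]
  note intn = set_integrable_borel_subset[OF M integrable_norm[OF h]]
  have nn: "0 \<le> (LINT x:A|M. norm (h x))" for A
    by (simp add: set_lebesgue_integral_def)
  have sums: "(\<Sum>i. ennreal (LINT x:A i|M. norm (h x))) = ennreal (LINT x:E|M. norm (h x))"
    if "\<And>i::nat. A i \<in> borel_subsets \<Omega>" "disjoint_family A" "(\<Union>i. A i) = E" for A
    using finite_radon_sums[OF finite_radon_density[OF M integrable_norm[OF h]] that(1,2)]
    by (intro suminf_ennreal_eq nn) (simp add: that(3))
  show "variation \<Omega> \<nu> E \<le> ennreal (LINT x:E|M. norm (h x))"
  proof (rule variation_least)
    fix A :: "nat \<Rightarrow> _"
    assume A: "\<And>i. A i \<in> borel_subsets \<Omega>" "disjoint_family A" "(\<Union>i. A i) = E"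
    have "norm (\<nu> (A i)) \<le> (LINT x:A i|M. norm (h x))" for i
      unfolding \<nu>[OF A(1)] by (rule set_integral_norm_bound[OF int[OF A(1)]])
    then have "(\<Sum>i. ennreal (norm (\<nu> (A i)))) \<le> (\<Sum>i. ennreal (LINT x:A i|M. norm (h x)))"
      by (intro suminf_le ennreal_leI) auto
    also have "\<dots> = ennreal (LINT x:E|M. norm (h x))" by (rule sums[OF A])
    finally show "(\<Sum>i. ennreal (norm (\<nu> (A i)))) \<le> ennreal (LINT x:E|M. norm (h x))" .
  qed
  show "ennreal (LINT x:E|M. norm (h x)) \<le> variation \<Omega> \<nu> E"
  proof (rule ennreal_le_epsilon)
    fix e :: real assume "0 < e"
    \<comment> \<open>Chosen so that the total error \<open>2 * \<delta> * measure M E\<close> is at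
      most \<open>e\<close>; the \<open>+ 1\<close> keeps the denominator positive when
      \<open>E\<close> is null.\<close>
    define \<delta> where "\<delta> = e / (2 * (measure M E + 1))"
    have \<delta>: "0 < \<delta>" using \<open>0 < e\<close> measure_nonneg[of M E] by (simp add: \<delta>_def add_nonneg_pos)
    obtain D :: "'b set" where D: "countable D" "\<And>X. open X \<Longrightarrow> X \<noteq> {} \<Longrightarrow> \<exists>d\<in>D. d \<in> X"
      by (rule countable_dense_setE) blast
    have "D \<noteq> {}" using D(2)[of UNIV] by auto
    define c where "c = from_nat_into D"
    \<comment> \<open>As \<open>c\<close> runs through a dense set, every value of \<open>h\<close>
      lies within \<delta> of some \<open>c k\<close>, so the sets \<open>B k\<close> cover
      \<open>E\<close>; \<open>disjointed\<close> turns the cover into a partition.\<close>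
    define B where "B k = h -` ball (c k) \<delta> \<inter> E" for k
    define A where "A = disjointed B"
    have B: "B k \<in> borel_subsets \<Omega>" for k
    proof -
      have "h -` ball (c k) \<delta> \<inter> space M \<in> sets M"
        using h by (intro measurable_sets[of _ _ borel]) auto
      moreover have "B k = h -` ball (c k) \<delta> \<inter> space M \<inter> E"
        using sets.sets_into_space[of E M] E M by (auto simp: B_def)
      ultimately show ?thesis using E M by auto
    qed
    have "A k \<in> borel_subsets \<Omega>" for k
      unfolding A_def disjointed_def using B by (intro Diff_borel_subsets UN_borel_subsets) auto
    moreover have "(\<Union>k. A k) = E"
    proof -
      have "\<exists>k. x \<in> B k" if "x \<in> E" for x
      proof -
        obtain d where "d \<in> D" "d \<in> ball (h x) \<delta>" using D(2)[of "ball (h x) \<delta>"] \<delta> by auto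
        moreover obtain k where "d = c k"
          using from_nat_into_surj[OF D(1) \<open>d \<in> D\<close>] by (auto simp: c_def)
        ultimately show ?thesis using that by (auto simp: B_def dist_commute)
      qed
      then show ?thesis unfolding A_def UN_disjointed_eq by (auto simp: B_def)
    qed
    moreover have "disjoint_family A" by (simp add: A_def disjoint_family_disjointed)
    ultimately have A: "\<And>k. A k \<in> borel_subsets \<Omega>" "disjoint_family A" "(\<Union>k. A k) = E" by blast+
    have Am: "A k \<in> sets M" for k using A M by simp
    have near: "dist (c k) (h x) \<le> \<delta>" if "x \<in> A k" for x k
      using that disjointed_subset[of B k] by (auto simp: A_def B_def)
    \<comment> \<open>For a constant, the integral of the norm and the norm of the integral agree.
      Replacing \<open>h\<close> by \<open>c k\<close> costs \<delta> times the measure of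
      \<open>A k\<close> in each of the two quantities, hence the factor 2.\<close>
    have step: "(LINT x:A k|M. norm (h x)) \<le> norm (\<nu> (A k)) + 2 * \<delta> * measure M (A k)" for k
    proof -
      have const: "set_integrable M (A k) (\<lambda>x. y)" for y :: 'b
        by (intro set_integrable_borel_subset[OF M] A) simp
      have constr: "set_integrable M (A k) (\<lambda>x. y)" for y :: real
        by (intro set_integrable_borel_subset[OF M] A) simp
      have "(LINT x:A k|M. norm (h x)) \<le> (LINT x:A k|M. norm (c k) + \<delta>)"
      proof (rule set_integral_mono[OF intn[OF A(1)] constr])
        fix x assume "x \<in> A k"
        from near[OF this] show "norm (h x) \<le> norm (c k) + \<delta>"
          using norm_triangle_ineq2[of "h x" "c k"] by (simp add: dist_norm norm_minus_commute)
      qed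
      also have "\<dots> = (norm (c k) + \<delta>) * measure M (A k)"
        using Am[of k] by (simp add: set_integral_const)
      finally have 1: "(LINT x:A k|M. norm (h x)) \<le> (norm (c k) + \<delta>) * measure M (A k)" .
      have "(LINT x:A k|M. c k - h x) = (LINT x:A k|M. c k) - \<nu> (A k)"
        unfolding \<nu>[OF A(1)] by (rule set_integral_diff(2)[OF const int[OF A(1)]])
      then have "(LINT x:A k|M. c k) = \<nu> (A k) + (LINT x:A k|M. c k - h x)" by simp
      then have "norm (LINT x:A k|M. c k) \<le> norm (\<nu> (A k)) + norm (LINT x:A k|M. c k - h x)"
        by (metis norm_triangle_ineq)
      moreover have "norm (LINT x:A k|M. c k - h x) \<le> \<delta> * measure M (A k)"
      proof -
        have i: "set_integrable M (A k) (\<lambda>x. c k - h x)"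
          by (rule set_integral_diff(1)[OF const int[OF A(1)]])
        have "norm (LINT x:A k|M. c k - h x) \<le> (LINT x:A k|M. norm (c k - h x))"
          by (rule set_integral_norm_bound[OF i])
        also have "\<dots> \<le> (LINT x:A k|M. \<delta>)"
          using near by (intro set_integral_mono set_integrable_norm i constr) (auto simp: dist_norm)
        also have "\<dots> = \<delta> * measure M (A k)"
          using Am[of k] by (simp add: set_integral_const)
        finally show ?thesis .
      qed
      moreover have "norm (LINT x:A k|M. c k) = norm (c k) * measure M (A k)"
        using Am[of k] by (simp add: set_integral_const)
      ultimately show ?thesis using 1 by (simp add: algebra_simps)
    qed
    have "ennreal (LINT x:E|M. norm (h x)) = (\<Sum>k. ennreal (LINT x:A k|M. norm (h x)))"
      by (rule sums[OF A, symmetric])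
    also have "\<dots> \<le> (\<Sum>k. ennreal (norm (\<nu> (A k))) + ennreal (2 * \<delta>) * emeasure M (A k))"
    proof (intro suminf_le)
      fix k
      have "ennreal (LINT x:A k|M. norm (h x)) \<le> ennreal (norm (\<nu> (A k)) + 2 * \<delta> * measure M (A k))"
        by (rule ennreal_leI[OF step])
      also have "\<dots> = ennreal (norm (\<nu> (A k))) + ennreal (2 * \<delta>) * emeasure M (A k)"
        using \<delta> by (simp add: emeasure_eq_measure ennreal_mult' ennreal_plus)
      finally show "ennreal (LINT x:A k|M. norm (h x)) \<le>
        ennreal (norm (\<nu> (A k))) + ennreal (2 * \<delta>) * emeasure M (A k)" .
    qed auto
    also have "\<dots> = (\<Sum>k. ennreal (norm (\<nu> (A k)))) + ennreal (2 * \<delta>) * emeasure M E"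
    proof -
      have "(\<Sum>k. emeasure M (A k)) = emeasure M E"
        using A Am by (subst suminf_emeasure) auto
      then show ?thesis by (subst suminf_add[symmetric]) auto
    qed
    also have "\<dots> \<le> variation \<Omega> \<nu> E + ennreal e"
    proof (rule add_mono)
      show "(\<Sum>k. ennreal (norm (\<nu> (A k)))) \<le> variation \<Omega> \<nu> E" by (rule variation_upper[OF A])
      have "2 * \<delta> * measure M E \<le> e"
        using \<open>0 < e\<close> measure_nonneg[of M E]
        by (simp add: \<delta>_def divide_simps add_nonneg_pos del: measure_nonneg)
      then show "ennreal (2 * \<delta>) * emeasure M E \<le> ennreal e"
        using \<delta> by (simp add: emeasure_eq_measure ennreal_leI flip: ennreal_mult')
    qed
    finally show "ennreal (LINT x:E|M. norm (h x)) \<le> variation \<Omega> \<nu> E + ennreal e" .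
  qed
qed

text \<open>Radon-Nikodym. The derivative takes values in \<open>ennreal\<close>; since
  \<open>M\<close> and the second measure are finite, it agrees almost everywhere with a nonnegative
  real function, which serves as \<open>f\<close>.\<close>

lemma finite_radon_has_density_nonneg:
  assumes "finite_measure M" and M: "sets M = borel_subsets \<Omega>"
    and \<mu>: "finite_radon \<Omega> \<mu>" "positive_on \<Omega> \<mu>"
    and ac: "\<And>E. E \<in> borel_subsets \<Omega> \<Longrightarrow> emeasure M E = 0 \<Longrightarrow> \<mu> E = 0"
  obtains f where "integrable M f" "\<And>x. 0 \<le> f x"
    "\<And>E. E \<in> borel_subsets \<Omega> \<Longrightarrow> \<mu> E = (LINT x:E|M. f x)"
proof -
  interpret finite_measure M by fact
  define N where "N = to_measure \<Omega> \<mu>"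
  have N: "finite_measure N" "sets N = sets M"
    unfolding N_def by (auto intro: finite_measure_to_measure \<mu> simp: M)
  have a: "absolutely_continuous M N"
    using ac M by (auto simp: absolutely_continuous_def null_sets_def N_def emeasure_to_measure[OF \<mu>])
  obtain D where D: "D \<in> borel_measurable M" "AE x in M. RN_deriv M N x = ennreal (D x)"
    "\<And>x. 0 \<le> D x"
    using real_RN_deriv[OF N(1) a N(2)] by metis
  have *: "has_bochner_integral M (\<lambda>x. indicator E x *\<^sub>R D x) (\<mu> E)" if E: "E \<in> borel_subsets \<Omega>" for E
  proof (rule has_bochner_integral_nn_integral)
    have Em: "E \<in> sets M" using E M by simp
    show "(\<lambda>x. indicator E x *\<^sub>R D x) \<in> borel_measurable M" using D(1) Em by simp
    show "0 \<le> \<mu> E" using \<mu>(2) E by (auto simp: positive_on_def)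
    show "AE x in M. 0 \<le> indicator E x *\<^sub>R D x" using D(3) by simp
    have "(\<integral>\<^sup>+x. ennreal (indicator E x *\<^sub>R D x) \<partial>M) = (\<integral>\<^sup>+x. RN_deriv M N x * indicator E x \<partial>M)"
      using D(2) by (intro nn_integral_cong_AE) (auto simp: indicator_def)
    also have "\<dots> = emeasure (density M (RN_deriv M N)) E"
      using Em by (simp add: emeasure_density)
    also have "\<dots> = emeasure N E" by (simp only: density_RN_deriv[OF a N(2)])
    also have "\<dots> = ennreal (\<mu> E)"
      unfolding N_def by (rule emeasure_to_measure[OF \<mu> E])
    finally show "(\<integral>\<^sup>+x. ennreal (indicator E x *\<^sub>R D x) \<partial>M) = ennreal (\<mu> E)" .
  qed
  have sp: "space M = \<Omega>"
    using sets_eq_imp_space_eq[of M "to_measure \<Omega> \<mu>"] M by simp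
  show ?thesis
  proof
    \<comment> \<open>Integrability comes from the representation on the whole space, where the
      indicator is 1.\<close>
    have "integrable M (\<lambda>x. indicator \<Omega> x *\<^sub>R D x)" using * by (auto simp: has_bochner_integral_iff)
    then show "integrable M D" by (rule Bochner_Integration.integrable_cong[THEN iffD1, rotated 2]) (auto simp: sp)
  qed (use * D in \<open>auto simp: has_bochner_integral_iff set_lebesgue_integral_def\<close>)
qed

text \<open>Works one coordinate at a time. A coordinate of \<nu> is bounded in absolute value by
  \<open>m\<close>, so adding \<open>m\<close> makes it positive while it still vanishes on null
  sets of \<open>m\<close>, and the scalar Radon-Nikodym lemma applies.\<close>

lemma finite_radon_has_density:
  fixes \<nu> :: "'a::euclidean_space set \<Rightarrow> 'b::euclidean_space"
  assumes m: "finite_radon \<Omega> m" "positive_on \<Omega> m" and \<nu>: "finite_radon \<Omega> \<nu>"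
    and le: "\<And>E. E \<in> borel_subsets \<Omega> \<Longrightarrow> norm (\<nu> E) \<le> m E"
  obtains h where "integrable (to_measure \<Omega> m) h"
    "\<And>E. E \<in> borel_subsets \<Omega> \<Longrightarrow> \<nu> E = (LINT x:E|to_measure \<Omega> m. h x)"
proof -
  define M where "M = to_measure \<Omega> m"
  have M: "sets M = borel_subsets \<Omega>" "finite_measure M"
    by (simp_all add: M_def finite_measure_to_measure m)
  interpret finite_measure M by fact
  have meas: "measure M E = m E" if "E \<in> borel_subsets \<Omega>" for E
    using that m by (simp add: M_def measure_def emeasure_to_measure positive_on_def)
  have "\<exists>f. integrable M f \<and> (\<forall>E\<in>borel_subsets \<Omega>. \<nu> E \<bullet> b + m E = (LINT x:E|M. f x))"
    if b: "b \<in> Basis" for b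
  proof (rule finite_radon_has_density_nonneg[OF M(2,1)])
    show "finite_radon \<Omega> (\<lambda>E. \<nu> E \<bullet> b + m E)"
      by (intro finite_radon_add finite_radon_inner \<nu> m)
    have bd: "\<bar>\<nu> E \<bullet> b\<bar> \<le> m E" if "E \<in> borel_subsets \<Omega>" for E
      using le[OF that] Basis_le_norm[OF b, of "\<nu> E"] by simp
    then show "positive_on \<Omega> (\<lambda>E. \<nu> E \<bullet> b + m E)"
      by (fastforce simp: positive_on_def)
    show "\<nu> E \<bullet> b + m E = 0" if "E \<in> borel_subsets \<Omega>" "emeasure M E = 0" for E
      using bd[OF that(1)] meas[OF that(1)] that(2) by (simp add: measure_def)
  qed blast
  then obtain f where f: "\<And>b. b \<in> Basis \<Longrightarrow> integrable M (f b)"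
    "\<And>b E. b \<in> Basis \<Longrightarrow> E \<in> borel_subsets \<Omega> \<Longrightarrow> \<nu> E \<bullet> b + m E = (LINT x:E|M. f b x)"
    by metis
  show ?thesis
  proof
    \<comment> \<open>Subtracting 1, the density of \<open>m\<close> with respect to itself, undoes
      the shift by \<open>m\<close>.\<close>
    show "integrable (to_measure \<Omega> m) (\<lambda>x. \<Sum>b\<in>Basis. (f b x - 1) *\<^sub>R b)"
      using f(1) unfolding M_def[symmetric] by (intro Bochner_Integration.integrable_sum
        integrable_scaleR_left Bochner_Integration.integrable_diff) auto
    fix E assume E: "E \<in> borel_subsets \<Omega>"
    have 1: "(LINT x:E|M. f b x - 1) = \<nu> E \<bullet> b" if "b \<in> Basis" for b
    proof -
      have "(LINT x:E|M. f b x - 1) = (LINT x:E|M. f b x) - (LINT x:E|M. 1)"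
        using f(1)[OF that] E by (intro set_integral_diff set_integrable_borel_subset[OF M(1)]) auto
      also have "(LINT x:E|M. 1) = m E"
        using E M by (simp add: set_integral_const meas)
      finally show ?thesis using f(2)[OF that E] by simp
    qed
    have "(LINT x:E|M. \<Sum>b\<in>Basis. (f b x - 1) *\<^sub>R b) =
        (LINT x|M. (\<Sum>b\<in>Basis. (indicator E x *\<^sub>R (f b x - 1)) *\<^sub>R b))"
      by (simp add: set_lebesgue_integral_def scaleR_sum_right)
    also have "\<dots> = (\<Sum>b\<in>Basis. LINT x|M. (indicator E x *\<^sub>R (f b x - 1)) *\<^sub>R b)"
      using f(1) E M by (intro Bochner_Integration.integral_sum integrable_scaleR_left
        integrable_mult_indicator Bochner_Integration.integrable_diff) auto
    also have "\<dots> = (\<Sum>b\<in>Basis. (LINT x:E|M. f b x - 1) *\<^sub>R b)"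
      using f(1) E M unfolding set_lebesgue_integral_def
      by (intro sum.cong refl integral_scaleR_left integrable_mult_indicator
        Bochner_Integration.integrable_diff) auto
    also have "\<dots> = \<nu> E" using 1 by (simp add: euclidean_representation)
    finally show "\<nu> E = (LINT x:E|to_measure \<Omega> m. \<Sum>b\<in>Basis. (f b x - 1) *\<^sub>R b)"
      unfolding M_def ..
  qed
qed

section \<open>Hahn sets and positive parts\<close>

text \<open>\<open>E \<inter> P - Q\<close> lies in a positive and in a negative set, so its value
  is zero; the same holds with the roles exchanged. Hence the choice made in
  \<open>positive_part\<close> can be replaced by any explicit Hahn set.\<close>

lemma hahn_set_Int_eq:
  assumes \<mu>: "finite_radon \<Omega> \<mu>" and P: "hahn_set \<Omega> \<mu> P" and Q: "hahn_set \<Omega> \<mu> Q"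
    and E: "E \<in> borel_subsets \<Omega>"
  shows "\<mu> (E \<inter> P) = \<mu> (E \<inter> Q)"
proof -
  have *: "\<mu> (E \<inter> P) = \<mu> (E \<inter> P \<inter> Q)" if P: "hahn_set \<Omega> \<mu> P" and Q: "hahn_set \<Omega> \<mu> Q" for P Q
  proof -
    have B: "P \<in> borel_subsets \<Omega>" "Q \<in> borel_subsets \<Omega>" using P Q by (auto simp: hahn_set_def)
    have "E \<inter> P - Q \<in> borel_subsets \<Omega>" "E \<inter> P - Q \<subseteq> P" "E \<inter> P - Q \<subseteq> \<Omega> - Q"
      using E B borel_subsets_subset[OF E] by auto
    then have "\<mu> (E \<inter> P - Q) = 0" using P Q unfolding hahn_set_def by (meson antisym)
    moreover have "\<mu> ((E \<inter> P - Q) \<union> (E \<inter> P \<inter> Q)) = \<mu> (E \<inter> P - Q) + \<mu> (E \<inter> P \<inter> Q)"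
      using E B by (intro finite_radon_Un[OF \<mu>]) auto
    moreover have "(E \<inter> P - Q) \<union> (E \<inter> P \<inter> Q) = E \<inter> P" by auto
    ultimately show ?thesis by simp
  qed
  have "E \<inter> P \<inter> Q = E \<inter> Q \<inter> P" by auto
  then show ?thesis using *[OF P Q] *[OF Q P] by simp
qed

lemma positive_set_borel_subset:
  fixes f :: "'a::euclidean_space \<Rightarrow> real"
  assumes M: "sets M = borel_subsets \<Omega>" and f: "f \<in> borel_measurable M"
  shows "{x\<in>\<Omega>. 0 < f x} \<in> borel_subsets \<Omega>"
proof -
  have "space M = \<Omega>"
    using sets_eq_imp_space_eq[of M "to_measure \<Omega> (\<lambda>_. 0)"] M by simp
  moreover have "{x\<in>space M. 0 < f x} \<in> sets M" using f by measurable
  ultimately show ?thesis by (simp add: M)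
qed

text \<open>The set where the density is positive is a Hahn set. Both forms are used later: the
  integral to compute the norm, the value on the Hahn set to compare it with competitors.\<close>

lemma positive_part_density:
  assumes M: "sets M = borel_subsets \<Omega>" and f: "integrable M f"
    and \<mu>: "\<And>E. E \<in> borel_subsets \<Omega> \<Longrightarrow> \<mu> E = (LINT x:E|M. f x)"
    and E: "E \<in> borel_subsets \<Omega>"
  shows "positive_part \<Omega> \<mu> E = (LINT x:E|M. max 0 (f x))"
    and "positive_part \<Omega> \<mu> E = \<mu> (E \<inter> {x\<in>\<Omega>. 0 < f x})"
proof -
  define P where "P = {x\<in>\<Omega>. 0 < f x}"
  have sp: "space M = \<Omega>"
    using sets_eq_imp_space_eq[of M "to_measure \<Omega> \<mu>"] M by simp
  have P: "{x\<in>\<Omega>. 0 < f x} \<in> borel_subsets \<Omega>"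
    using positive_set_borel_subset[OF M] f by blast
  have rad: "finite_radon \<Omega> \<mu>"
    by (rule finite_radon_cong[OF \<mu>[symmetric] finite_radon_density[OF M f]])
  have hP: "hahn_set \<Omega> \<mu> P"
    unfolding hahn_set_def
  proof (intro conjI ballI impI)
    fix F assume F: "F \<in> borel_subsets \<Omega>"
    show "0 \<le> \<mu> F" if "F \<subseteq> P"
      unfolding \<mu>[OF F] set_lebesgue_integral_def using that
      by (intro integral_nonneg_AE AE_I2) (auto simp: indicator_def P_def)
    show "\<mu> F \<le> 0" if "F \<subseteq> \<Omega> - P"
    proof -
      have "0 \<le> (LINT x|M. - (indicator F x *\<^sub>R f x))"
        using that by (intro integral_nonneg_AE AE_I2) (auto simp: indicator_def P_def)
      then show ?thesis by (simp add: \<mu>[OF F] set_lebesgue_integral_def)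
    qed
  qed (simp add: P_def P)
  have "positive_part \<Omega> \<mu> E = \<mu> (E \<inter> P)"
    unfolding positive_part_def by (rule hahn_set_Int_eq[OF rad someI[of "hahn_set \<Omega> \<mu>", OF hP] hP E])
  then show pp: "positive_part \<Omega> \<mu> E = \<mu> (E \<inter> {x\<in>\<Omega>. 0 < f x})" by (simp add: P_def)
  also have "\<dots> = (LINT x:E \<inter> {x\<in>\<Omega>. 0 < f x}|M. f x)" using E P by (intro \<mu>) auto
  also have "\<dots> = (LINT x:E|M. max 0 (f x))"
    unfolding set_lebesgue_integral_def
    by (intro Bochner_Integration.integral_cong refl) (auto simp: indicator_def sp)
  finally show "positive_part \<Omega> \<mu> E = (LINT x:E|M. max 0 (f x))" .
qed

section \<open>Lower bound, truncation and the minimum\<close>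

lemma variation_triangle:
  assumes "finite_radon \<Omega> \<mu>" "finite_radon \<Omega> \<nu>"
  shows "variation \<Omega> (\<lambda>E. \<mu> E + \<nu> E) E \<le> variation \<Omega> \<mu> E + variation \<Omega> \<nu> E"
proof (rule variation_least)
  fix A :: "nat \<Rightarrow> _"
  assume A: "\<And>i. A i \<in> borel_subsets \<Omega>" "disjoint_family A" "(\<Union>i. A i) = E"
  have "(\<Sum>i. ennreal (norm (\<mu> (A i) + \<nu> (A i)))) \<le>
      (\<Sum>i. ennreal (norm (\<mu> (A i))) + ennreal (norm (\<nu> (A i))))"
    by (intro suminf_le) (auto simp: norm_triangle_ineq ennreal_leI simp flip: ennreal_plus)
  also have "\<dots> = (\<Sum>i. ennreal (norm (\<mu> (A i)))) + (\<Sum>i. ennreal (norm (\<nu> (A i))))"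
    by (intro suminf_add[symmetric]) auto
  also have "\<dots> \<le> variation \<Omega> \<mu> E + variation \<Omega> \<nu> E"
    by (intro add_mono variation_upper A)
  finally show "(\<Sum>i. ennreal (norm (\<mu> (A i) + \<nu> (A i)))) \<le> variation \<Omega> \<mu> E + variation \<Omega> \<nu> E" .
qed

text \<open>The triangle inequality for \<nu> as the sum of \<open>\<nu> - g\<close> and
  \<open>g\<close> is applied on \<open>P\<close>, where the variation of \<open>g\<close> is at
  most \<open>\<gamma> P\<close>; monotonicity then passes from \<open>P\<close> to \<Omega>. All
  variations are finite, so the subtraction can be done in the reals.\<close>

lemma positive_part_le_radon_norm_diff:
  fixes \<nu> g :: "'a::euclidean_space set \<Rightarrow> 'b::euclidean_space"
  assumes \<nu>: "finite_radon \<Omega> \<nu>" and g: "finite_radon \<Omega> g"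
    and le: "measure_le \<Omega> (variation_measure \<Omega> g) \<gamma>" and P: "P \<in> borel_subsets \<Omega>"
  shows "ennreal (variation_measure \<Omega> \<nu> P - \<gamma> P) \<le> radon_norm \<Omega> (\<nu> - g)"
proof -
  have d: "finite_radon \<Omega> (\<nu> - g)"
    using finite_radon_diff[OF \<nu> g] by (simp add: fun_diff_def)
  have "variation \<Omega> \<nu> P = variation \<Omega> (\<lambda>E. (\<nu> - g) E + g E) P" by simp
  also have "\<dots> \<le> variation \<Omega> (\<nu> - g) P + variation \<Omega> g P"
    by (rule variation_triangle[OF d g])
  finally have "ennreal (variation_measure \<Omega> \<nu> P) \<le>
      ennreal (variation_measure \<Omega> (\<nu> - g) P) + ennreal (variation_measure \<Omega> g P)"
    by (simp only: ennreal_variation_measure \<nu> g d)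
  then have "variation_measure \<Omega> \<nu> P \<le> variation_measure \<Omega> (\<nu> - g) P + variation_measure \<Omega> g P"
    by (simp add: variation_measure_def flip: ennreal_plus)
  moreover have "variation_measure \<Omega> g P \<le> \<gamma> P"
    using le P by (simp add: measure_le_def positive_on_def)
  ultimately have "variation_measure \<Omega> \<nu> P - \<gamma> P \<le> variation_measure \<Omega> (\<nu> - g) P" by simp
  then have "ennreal (variation_measure \<Omega> \<nu> P - \<gamma> P) \<le> variation \<Omega> (\<nu> - g) P"
    by (subst ennreal_variation_measure[OF d, symmetric]) (rule ennreal_leI)
  also have "\<dots> \<le> radon_norm \<Omega> (\<nu> - g)"
    unfolding radon_norm_def
    by (intro variation_mono finite_radon_empty[OF d] P) (auto dest: borel_subsets_subset[OF P, THEN subsetD])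
  finally show ?thesis .
qed

text \<open>This is the radial projection onto the ball of radius \<open>c\<close>. As
  \<open>c\<close> is nonnegative, \<open>h = 0\<close> falls into the first case, so no division by
  zero occurs.\<close>

lemma norm_min_scaleR:
  fixes h :: "'b::real_normed_vector"
  assumes "0 \<le> c"
  shows "norm ((if norm h \<le> c then 1 else c / norm h) *\<^sub>R h) = min (norm h) c"
    and "norm (h - (if norm h \<le> c then 1 else c / norm h) *\<^sub>R h) = max 0 (norm h - c)"
proof -
  show "norm ((if norm h \<le> c then 1 else c / norm h) *\<^sub>R h) = min (norm h) c"
    using assms by auto
  show "norm (h - (if norm h \<le> c then 1 else c / norm h) *\<^sub>R h) = max 0 (norm h - c)"
  proof (cases "norm h \<le> c")
    case False
    then have "norm h \<noteq> 0" using assms by auto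
    have "h - (c / norm h) *\<^sub>R h = (1 - c / norm h) *\<^sub>R h" by (simp add: algebra_simps)
    also have "norm \<dots> = norm h - c"
      using False assms \<open>norm h \<noteq> 0\<close> by (simp add: abs_if field_simps)
    finally show ?thesis using False by simp
  qed auto
qed

text \<open>The minimiser truncates the density \<open>h\<close> of \<open>\<nu>\<close> with respect to \<open>|\<nu>| + \<gamma>\<close> at the
  density \<open>c\<close> of \<open>\<gamma>\<close>; what remains has density of norm \<open>(|h| - c)\<^sub>+\<close>.\<close>

lemma Least_radon_norm_diff:
  fixes \<nu> :: "'a::euclidean_space set \<Rightarrow> 'b::euclidean_space"
  assumes \<nu>: "finite_radon \<Omega> \<nu>" and \<gamma>: "finite_radon \<Omega> \<gamma>" "positive_on \<Omega> \<gamma>"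
  shows "(LEAST t. \<exists>g. finite_radon \<Omega> g \<and> measure_le \<Omega> (variation_measure \<Omega> g) \<gamma> \<and>
      t = radon_norm \<Omega> (\<nu> - g)) =
    radon_norm \<Omega> (positive_part \<Omega> (variation_measure \<Omega> \<nu> - \<gamma>))"
proof -
  define m where "m E = variation_measure \<Omega> \<nu> E + \<gamma> E" for E
  have m: "finite_radon \<Omega> m" "positive_on \<Omega> m"
    unfolding m_def using finite_radon_add[OF finite_radon_variation_measure[OF \<nu>] \<gamma>(1)] \<gamma>(2)
    by (auto simp: positive_on_def variation_measure_def)
  have \<gamma>0: "0 \<le> \<gamma> E" if "E \<in> borel_subsets \<Omega>" for E
    using \<gamma>(2) that by (simp add: positive_on_def)
  have v0: "0 \<le> variation_measure \<Omega> \<nu> E" for E by (simp add: variation_measure_def)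
  define M where "M = to_measure \<Omega> m"
  have M: "finite_measure M" "sets M = borel_subsets \<Omega>"
    by (simp_all add: M_def finite_measure_to_measure m)
  have "norm (\<nu> E) \<le> m E" if "E \<in> borel_subsets \<Omega>" for E
  proof -
    have "norm (\<nu> E) \<le> variation_measure \<Omega> \<nu> E"
      using norm_le_variation[OF \<nu> that] v0 by (simp flip: ennreal_variation_measure[OF \<nu>])
    with \<gamma>0[OF that] show ?thesis by (simp add: m_def)
  qed
  then obtain h where h: "integrable M h" "\<And>E. E \<in> borel_subsets \<Omega> \<Longrightarrow> \<nu> E = (LINT x:E|M. h x)"
    unfolding M_def using finite_radon_has_density[OF m \<nu>] by metis
  have "\<gamma> E = 0" if "E \<in> borel_subsets \<Omega>" "emeasure M E = 0" for E
  proof -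
    \<comment> \<open>\<open>m E\<close> is a sum of two nonnegative terms, so both vanish with it;
      this is the absolute continuity of \<gamma>.\<close>
    have "m E = 0" using that m by (simp add: M_def emeasure_to_measure positive_on_def)
    with \<gamma>0[OF that(1)] v0[of E] show ?thesis by (simp add: m_def)
  qed
  then obtain c where c: "integrable M c" "\<And>x. 0 \<le> c x"
    "\<And>E. E \<in> borel_subsets \<Omega> \<Longrightarrow> \<gamma> E = (LINT x:E|M. c x)"
    using finite_radon_has_density_nonneg[OF M \<gamma>] by metis
  define k where "k x = (if norm (h x) \<le> c x then 1 else c x / norm (h x)) *\<^sub>R h x" for x
  have nk: "norm (k x) = min (norm (h x)) (c x)" "norm (h x - k x) = max 0 (norm (h x) - c x)" for x
    unfolding k_def by (rule norm_min_scaleR[OF c(2)])+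
  have k: "integrable M k"
  proof (rule Bochner_Integration.integrable_bound[OF h(1)])
    have "h \<in> borel_measurable M" "c \<in> borel_measurable M" using h(1) c(1) by auto
    then show "k \<in> borel_measurable M" unfolding k_def by measurable
  qed (simp add: nk)
  define g where "g E = (LINT x:E|M. k x)" for E
  have g: "finite_radon \<Omega> g" unfolding g_def by (rule finite_radon_density[OF M(2) k])
  note int = set_integrable_borel_subset[OF M(2)]
  have vd: "variation_measure \<Omega> \<mu> E = (LINT x:E|M. norm (f x))"
    if "integrable M f" "\<And>E. E \<in> borel_subsets \<Omega> \<Longrightarrow> \<mu> E = (LINT x:E|M. f x)" "E \<in> borel_subsets \<Omega>"
    for f and \<mu> :: "'a set \<Rightarrow> 'b" and E
    using variation_density[OF M that] by (simp add: variation_measure_def set_lebesgue_integral_def)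
  have le: "measure_le \<Omega> (variation_measure \<Omega> g) \<gamma>"
    unfolding measure_le_def positive_on_def
  proof
    fix E assume E: "E \<in> borel_subsets \<Omega>"
    have "variation_measure \<Omega> g E = (LINT x:E|M. norm (k x))"
      by (rule vd[OF k g_def E])
    also have "\<dots> \<le> (LINT x:E|M. c x)"
      by (intro set_integral_mono int integrable_norm k c(1) E) (simp add: nk)
    also have "\<dots> = \<gamma> E" by (simp add: c(3) E)
    finally show "0 \<le> (\<gamma> - variation_measure \<Omega> g) E" by simp
  qed
  let ?\<mu> = "variation_measure \<Omega> \<nu> - \<gamma>"
  have f: "integrable M (\<lambda>x. norm (h x) - c x)" using h(1) c(1) by simp
  have \<mu>: "?\<mu> E = (LINT x:E|M. norm (h x) - c x)" if E: "E \<in> borel_subsets \<Omega>" for E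
    using vd[OF h(1,2) E] c(3)[OF E]
    by (simp add: set_integral_diff int integrable_norm h(1) c(1) E)
  let ?P = "{x\<in>\<Omega>. 0 < norm (h x) - c x}"
  have P: "?P \<in> borel_subsets \<Omega>" using f by (intro positive_set_borel_subset[OF M(2)]) blast
  have pp: "positive_part \<Omega> ?\<mu> E = (LINT x:E|M. max 0 (norm (h x) - c x))"
    "positive_part \<Omega> ?\<mu> E = ?\<mu> (E \<inter> ?P)" if E: "E \<in> borel_subsets \<Omega>" for E
    by (rule positive_part_density[OF M(2) f \<mu> E]; assumption)+
  \<comment> \<open>The positive part has a nonnegative density, so its norm is simply the integral
    of that density.\<close>
  have "radon_norm \<Omega> (positive_part \<Omega> ?\<mu>) = ennreal (LINT x:\<Omega>|M. norm (max 0 (norm (h x) - c x)))"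
    unfolding radon_norm_def
    by (rule variation_density[OF M _ pp(1)]) (use f in auto)
  also have "\<dots> = ennreal (LINT x:\<Omega>|M. max 0 (norm (h x) - c x))" by simp
  finally have rhs: "radon_norm \<Omega> (positive_part \<Omega> ?\<mu>) = \<dots>" .
  have gm: "radon_norm \<Omega> (\<nu> - g) = radon_norm \<Omega> (positive_part \<Omega> ?\<mu>)"
  proof -
    have "radon_norm \<Omega> (\<nu> - g) = ennreal (LINT x:\<Omega>|M. norm (h x - k x))"
      unfolding radon_norm_def
    proof (rule variation_density[OF M])
      show "(\<nu> - g) E = (LINT x:E|M. h x - k x)" if "E \<in> borel_subsets \<Omega>" for E
        using that by (simp add: h(2) g_def set_integral_diff int h(1) k)
    qed (use h(1) k in auto)
    then show ?thesis by (simp add: rhs nk)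
  qed
  show ?thesis
  proof (rule Least_equality)
    show "\<exists>g. finite_radon \<Omega> g \<and> measure_le \<Omega> (variation_measure \<Omega> g) \<gamma> \<and>
        radon_norm \<Omega> (positive_part \<Omega> ?\<mu>) = radon_norm \<Omega> (\<nu> - g)"
      using g le gm by metis
    fix t assume "\<exists>g. finite_radon \<Omega> g \<and> measure_le \<Omega> (variation_measure \<Omega> g) \<gamma> \<and>
        t = radon_norm \<Omega> (\<nu> - g)"
    then obtain g where g: "finite_radon \<Omega> g" "measure_le \<Omega> (variation_measure \<Omega> g) \<gamma>"
      "t = radon_norm \<Omega> (\<nu> - g)" by blast
    \<comment> \<open>The second form of the positive part turns the norm into the value of the
      signed measure on the Hahn set \<open>?P\<close>, where the lower bound for an arbitrary
      competitor applies.\<close>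
    have "radon_norm \<Omega> (positive_part \<Omega> ?\<mu>) = ennreal (?\<mu> (\<Omega> \<inter> ?P))"
      by (simp only: rhs flip: pp[OF space_borel_subsets])
    also have "\<dots> = ennreal (variation_measure \<Omega> \<nu> ?P - \<gamma> ?P)"
      using borel_subsets_subset[OF P] by (simp only: Int_absorb1 minus_apply)
    also have "\<dots> \<le> t"
      unfolding g(3) by (rule positive_part_le_radon_norm_diff[OF \<nu> g(1,2) P])
    finally show "radon_norm \<Omega> (positive_part \<Omega> ?\<mu>) \<le> t" .
  qed
qed

theorem theorem5:
  fixes \<Omega> :: "(real ^ 'n) set"
    and \<gamma> :: "(real ^ 'n) set \<Rightarrow> real"
    and u :: "real ^ 'n \<Rightarrow> real"
  assumes "bounded_lipschitz_domain \<Omega>"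
    and "finite_radon \<Omega> \<gamma>" and "positive_on \<Omega> \<gamma>"
    and "u absolutely_integrable_on \<Omega>"
  shows "TV_pwL \<Omega> \<gamma> u =
    (if bounded_variation \<Omega> u
     then radon_norm \<Omega> (positive_part \<Omega> (variation_measure \<Omega> (gradient_measure \<Omega> u) - \<gamma>))
     else \<infinity>)"
proof (cases "bounded_variation \<Omega> u")
  case True
  \<comment> \<open>Bounded variation supplies a witness, so the choice in
    \<open>gradient_measure\<close> is a genuine gradient.\<close>
  then have "has_gradient_measure \<Omega> u (gradient_measure \<Omega> u)"
    unfolding gradient_measure_def bounded_variation_def by (metis someI_ex)
  then have "finite_radon \<Omega> (gradient_measure \<Omega> u)"
    by (simp add: has_gradient_measure_def)
  from Least_radon_norm_diff[OF this assms(2,3)] show ?thesis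
    by (simp only: TV_pwL_def True if_True)
qed (simp only: TV_pwL_def if_False)

end
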